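(* Let $k\ge2$ be an integer and $c\in(0,1/2)$. Let $n,r$ be integers with $n\ge r\ge1$ and let $w_1,\ldots,w_k$ be weighted $r$-uniform hypergraphs on $[n]$. If $w_i^*([n]\setminus\{j\})\ge1-c$ for every $i\in[k]$ and $j\in[n]$, then there is a chain of sets $\emptyset\subsetneq S_1\subsetneq\cdots\subsetneq S_n=[n]$ such that $|w_{i_1}^*(S_j)-w_{i_2}^*(S_j)|\le\sqrt{2(k-1)c}$ for all $i_1,i_2\in[k]$ and $j\in[n]$.
   Context: $[n]=\{1,\ldots,n\}$. For a finite set $S$, $S^{(r)}$ is the family of all $r$-element subsets of $S$. A weighted $r$-uniform hypergraph on $[n]$ is a function $w\colon[n]^{(r)}\to\mathbb{R}_{\ge0}$ with $\sum_{R\in[n]^{(r)}}w(R)=1$. For $S\subseteq[n]$, $w^*(S):=\sum_{R\in S^{(r)}}w(R)$ (so $w^*(S)=0$ if $|S|<r$). *)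

theory Defs
  imports Complex_Main "HOL-Library.Ramsey"
begin

text \<open>
  The family of all \<open>r\<close>-element subsets of a set \<open>S\<close> is the library's
  \<^term>\<open>nsets S r\<close>. A weight function has all sets of naturals as its HOL domain;
  its values outside \<^term>\<open>nsets {1..n} r\<close> are unconstrained, and they are never used
  when weights are summed over subsets of \<^term>\<open>{1..n}\<close>.
\<close>

definition weighted_hypergraph :: "nat \<Rightarrow> nat \<Rightarrow> (nat set \<Rightarrow> real) \<Rightarrow> bool" where
  "weighted_hypergraph n r w \<longleftrightarrow>
     (\<forall>R \<in> nsets {1..n} r. 0 \<le> w R) \<and> (\<Sum>R \<in> nsets {1..n} r. w R) = 1"

definition induced_weight :: "nat \<Rightarrow> (nat set \<Rightarrow> real) \<Rightarrow> nat set \<Rightarrow> real" where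
  "induced_weight r w S = (\<Sum>R \<in> nsets S r. w R)"

end

theory Submission
  imports Defs
begin

text \<open>
  Vertices are deleted one at a time, starting from the full vertex set. With
  \<open>y\<^sub>i = w\<^sub>i\<^sup>*(S)\<close>, the invariant is that the sum of \<open>(y\<^sub>i - y\<^sub>l)\<^sup>2\<close> over all ordered pairs
  is at most \<open>B = 2k(k-1)c\<close>. Averaged over the vertex deleted from \<open>S\<close>, each \<open>y\<^sub>i\<close> decreases
  by \<open>(r/|S|) y\<^sub>i\<close>, so the linear part of the change shrinks the sum by the
  factor \<open>1 - 2r/|S|\<close>, while the quadratic part adds at most \<open>(r/|S|) B\<close> since every vertex
  degree is at most \<open>c\<close>. (If \<open>|S| < 2r\<close>, the first contribution is nonpositive, and if \<open>|S| < r\<close>,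
  all weights vanish.) Hence some deletion preserves the invariant, which in turn bounds
  each single difference by \<open>sqrt (B/k)\<close>.
\<close>

text \<open>For nonempty finite \<open>I\<close> this is \<open>2 * (card I)^2\<close> times the
  variance of \<open>y\<close> over \<open>I\<close>.\<close>

definition spread :: "'i set \<Rightarrow> ('i \<Rightarrow> real) \<Rightarrow> real" where
  "spread I y = (\<Sum>i\<in>I. \<Sum>l\<in>I. (y i - y l)\<^sup>2)"

lemma spread_nonneg: "0 \<le> spread I y"
  unfolding spread_def by (intro sum_nonneg) auto

lemma spread_eq_0: "(\<And>i. i \<in> I \<Longrightarrow> y i = t) \<Longrightarrow> spread I y = 0"
  unfolding spread_def by simp

text \<open>After centring at \<open>t\<close>, the cross terms factor into the square of one sum.
  The point \<open>t\<close> is free so that the mean can be chosen, which removes that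
  square.\<close>

lemma spread_eq:
  "spread I y = 2 * real (card I) * (\<Sum>i\<in>I. (y i - t)\<^sup>2) - 2 * (\<Sum>i\<in>I. y i - t)\<^sup>2"
proof -
  have "spread I y = (\<Sum>i\<in>I. \<Sum>l\<in>I. (y i - t)\<^sup>2 + (y l - t)\<^sup>2 - 2 * ((y i - t) * (y l - t)))"
    unfolding spread_def by (intro sum.cong) (auto simp: power2_eq_square algebra_simps)
  also have "\<dots> = 2 * real (card I) * (\<Sum>i\<in>I. (y i - t)\<^sup>2)
      - 2 * ((\<Sum>i\<in>I. y i - t) * (\<Sum>i\<in>I. y i - t))"
    unfolding sum_product
    by (simp add: sum.distrib sum_subtractf flip: sum_distrib_left)
  finally show ?thesis by (simp add: power2_eq_square)
qed

text \<open>Around the mean, the deviations at \<open>a\<close> and \<open>b\<close> alone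
  contribute at least half of \<open>(y a - y b)^2\<close>. Keeping only the pairs
  \<open>(a, b)\<close> and \<open>(b, a)\<close> would give the factor 2 instead of
  \<open>card I\<close>, hence a weaker final constant once \<open>k > 2\<close>.\<close>

lemma card_mult_diff_square_le_spread:
  assumes "finite I" "a \<in> I" "b \<in> I"
  shows "real (card I) * (y a - y b)\<^sup>2 \<le> spread I y"
proof (cases "a = b")
  case True
  then show ?thesis by (simp add: spread_nonneg)
next
  case False
  define m where "m = (\<Sum>i\<in>I. y i) / card I"
  have "card I > 0" using assms by (auto simp: card_gt_0_iff)
  then have "(\<Sum>i\<in>I. y i - m) = 0"
    by (simp add: m_def sum_subtractf)
  then have spread: "spread I y = 2 * real (card I) * (\<Sum>i\<in>I. (y i - m)\<^sup>2)"
    by (simp add: spread_eq[of I y m])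
  have "0 \<le> ((y a - m) + (y b - m))\<^sup>2" by simp
  then have "(y a - y b)\<^sup>2 \<le> 2 * ((y a - m)\<^sup>2 + (y b - m)\<^sup>2)"
    by (simp add: power2_eq_square algebra_simps)
  also have "(y a - m)\<^sup>2 + (y b - m)\<^sup>2 = (\<Sum>i\<in>{a, b}. (y i - m)\<^sup>2)"
    using False by simp
  also have "\<dots> \<le> (\<Sum>i\<in>I. (y i - m)\<^sup>2)"
    using assms by (intro sum_mono2) auto
  finally have "(y a - y b)\<^sup>2 \<le> 2 * (\<Sum>i\<in>I. (y i - m)\<^sup>2)" by simp
  then have "real (card I) * (y a - y b)\<^sup>2 \<le> real (card I) * (2 * (\<Sum>i\<in>I. (y i - m)\<^sup>2))"
    by (intro mult_left_mono) auto
  then show ?thesis using spread by simp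
qed

text \<open>For values in \<open>[0, c]\<close>, the distance of \<open>x i\<close> and
  \<open>x l\<close> is at most \<open>c\<close> and also at most \<open>x i + x l\<close>; the
  square is bounded by the product of the two bounds. The diagonal vanishes, whence
  \<open>card I - 1\<close> and not \<open>card I\<close>.\<close>

lemma spread_le_sum:
  fixes x :: "'i \<Rightarrow> real"
  assumes "finite I" and x: "\<And>i. i \<in> I \<Longrightarrow> 0 \<le> x i \<and> x i \<le> c"
  shows "spread I x \<le> 2 * (real (card I) - 1) * c * (\<Sum>i\<in>I. x i)"
proof -
  \<comment> \<open>The subtracted \<open>2 * c * x i\<close> is the bound
    \<open>c * (x i + x l)\<close> at \<open>l = i\<close>, where the true term is 0.\<close>
  have "(\<Sum>l\<in>I. (x i - x l)\<^sup>2) \<le> c * (\<Sum>l\<in>I. x i + x l) - 2 * c * x i" if i: "i \<in> I" for i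
  proof -
    have "(x i - x l)\<^sup>2 \<le> c * (x i + x l)" if "l \<in> I" for l
    proof -
      have "\<bar>x i - x l\<bar> * \<bar>x i - x l\<bar> \<le> c * (x i + x l)"
        using x[OF i] x[OF that] by (intro mult_mono) auto
      then show ?thesis by (simp add: power2_eq_square)
    qed
    then have "(\<Sum>l\<in>I - {i}. (x i - x l)\<^sup>2) \<le> (\<Sum>l\<in>I - {i}. c * (x i + x l))"
      by (intro sum_mono) auto
    then show ?thesis
      using assms(1) i by (simp add: sum.remove[of I i] algebra_simps sum_distrib_left)
  qed
  then have "spread I x \<le> (\<Sum>i\<in>I. c * (\<Sum>l\<in>I. x i + x l) - 2 * c * x i)"
    unfolding spread_def by (rule sum_mono)
  also have "\<dots> = 2 * (real (card I) - 1) * c * (\<Sum>i\<in>I. x i)"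
    by (simp add: sum.distrib sum_subtractf flip: sum_distrib_left) (simp add: algebra_simps)
  finally show ?thesis .
qed

text \<open>Here \<open>x j\<close> is the loss caused by deleting \<open>j\<close>. When the
  squares are expanded, \<open>avg\<close> turns the cross terms, summed over \<open>j\<close>, into
  a multiple of \<open>spread I y\<close>; the squared losses remain.\<close>

lemma sum_spread_diff:
  assumes avg: "\<And>i. i \<in> I \<Longrightarrow> (\<Sum>j\<in>S. x j i) = \<rho> * y i"
  shows "(\<Sum>j\<in>S. spread I (\<lambda>i. y i - x j i))
    = (real (card S) - 2 * \<rho>) * spread I y + (\<Sum>j\<in>S. spread I (x j))"
proof -
  have "(\<Sum>j\<in>S. spread I (\<lambda>i. y i - x j i))
      = (\<Sum>j\<in>S. spread I y + spread I (x j)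
          - 2 * (\<Sum>i\<in>I. \<Sum>l\<in>I. (y i - y l) * (x j i - x j l)))"
    unfolding spread_def sum_distrib_left sum.distrib[symmetric] sum_subtractf[symmetric]
    by (intro sum.cong) (auto simp: power2_eq_square algebra_simps)
  also have "\<dots> = real (card S) * spread I y + (\<Sum>j\<in>S. spread I (x j))
      - 2 * (\<Sum>j\<in>S. \<Sum>i\<in>I. \<Sum>l\<in>I. (y i - y l) * (x j i - x j l))"
    by (simp add: sum.distrib sum_subtractf sum_distrib_left)
  also have "(\<Sum>j\<in>S. \<Sum>i\<in>I. \<Sum>l\<in>I. (y i - y l) * (x j i - x j l))
      = (\<Sum>i\<in>I. \<Sum>j\<in>S. \<Sum>l\<in>I. (y i - y l) * (x j i - x j l))"
    by (rule sum.swap)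
  also have "\<dots> = (\<Sum>i\<in>I. \<Sum>l\<in>I. \<Sum>j\<in>S. (y i - y l) * (x j i - x j l))"
    by (intro sum.cong refl sum.swap)
  also have "\<dots> = (\<Sum>i\<in>I. \<Sum>l\<in>I. \<rho> * (y i - y l)\<^sup>2)"
  proof (intro sum.cong refl)
    fix i l assume "i \<in> I" "l \<in> I"
    then have "(\<Sum>j\<in>S. x j i - x j l) = \<rho> * (y i - y l)"
      by (simp add: sum_subtractf avg right_diff_distrib)
    then show "(\<Sum>j\<in>S. (y i - y l) * (x j i - x j l)) = \<rho> * (y i - y l)\<^sup>2"
      by (simp add: power2_eq_square mult_ac flip: sum_distrib_left)
  qed
  also have "\<dots> = \<rho> * spread I y"
    by (simp add: spread_def sum_distrib_left)
  finally show ?thesis by (simp add: algebra_simps)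
qed

lemma exists_spread_diff_le:
  fixes x :: "'j \<Rightarrow> 'i \<Rightarrow> real"
  defines "B I c \<equiv> 2 * real (card I) * (real (card I) - 1) * c"
  assumes I: "finite I" "I \<noteq> {}" and S: "finite S" "S \<noteq> {}"
    and x: "\<And>i j. i \<in> I \<Longrightarrow> j \<in> S \<Longrightarrow> 0 \<le> x j i \<and> x j i \<le> c"
    and avg: "\<And>i. i \<in> I \<Longrightarrow> (\<Sum>j\<in>S. x j i) = \<rho> * y i"
    and y: "\<And>i. i \<in> I \<Longrightarrow> y i \<le> 1"
    and \<rho>: "0 \<le> \<rho>" "\<rho> \<le> real (card S)"
    and c: "0 \<le> c"
    and le: "spread I y \<le> B I c"
  shows "\<exists>j\<in>S. spread I (\<lambda>i. y i - x j i) \<le> B I c"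
proof (rule ccontr)
  assume "\<not> ?thesis"
  then have "\<And>j. j \<in> S \<Longrightarrow> B I c < spread I (\<lambda>i. y i - x j i)" by force
  then have "(\<Sum>j\<in>S. B I c) < (\<Sum>j\<in>S. spread I (\<lambda>i. y i - x j i))"
    using S by (intro sum_strict_mono) auto
  then have gt: "real (card S) * B I c < (\<Sum>j\<in>S. spread I (\<lambda>i. y i - x j i))" by simp
  have "card I > 0" using I by (auto simp: card_gt_0_iff)
  then have card: "real (card I) \<ge> 1" by simp
  have B: "0 \<le> B I c" using card c by (simp add: B_def)
  have "(\<Sum>j\<in>S. spread I (x j)) \<le> (\<Sum>j\<in>S. 2 * (real (card I) - 1) * c * (\<Sum>i\<in>I. x j i))"
    using x I by (intro sum_mono spread_le_sum) auto
  also have "\<dots> = 2 * (real (card I) - 1) * c * (\<Sum>i\<in>I. \<Sum>j\<in>S. x j i)"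
    by (subst sum.swap) (simp add: sum_distrib_left)
  also have "(\<Sum>i\<in>I. \<Sum>j\<in>S. x j i) = \<rho> * (\<Sum>i\<in>I. y i)"
    by (simp add: avg sum_distrib_left)
  \<comment> \<open>The bound \<open>y i <= 1\<close> supplies the factor \<open>card I\<close> that
    completes \<open>B\<close>.\<close>
  also have "2 * (real (card I) - 1) * c * \<dots> \<le> 2 * (real (card I) - 1) * c * (\<rho> * real (card I))"
    using sum_bounded_above[of I y 1] y \<rho> c card by (intro mult_left_mono) auto
  finally have quad: "(\<Sum>j\<in>S. spread I (x j)) \<le> \<rho> * B I c"
    by (simp add: B_def mult_ac)
  have "(\<Sum>j\<in>S. spread I (\<lambda>i. y i - x j i))
      \<le> (real (card S) - 2 * \<rho>) * spread I y + \<rho> * B I c"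
    using sum_spread_diff[OF avg, of I] quad by simp
  also have "\<dots> \<le> real (card S) * B I c"
  \<comment> \<open>The sign of the coefficient decides: if it is nonnegative, \<open>le\<close>
    gives the total \<open>(card S - \<rho>) * B\<close>; if negative, the first term is dropped and
    \<open>\<rho> \<le> card S\<close> suffices.\<close>
  proof (cases "2 * \<rho> \<le> real (card S)")
    case True
    then have "(real (card S) - 2 * \<rho>) * spread I y \<le> (real (card S) - 2 * \<rho>) * B I c"
      using le by (intro mult_left_mono) auto
    moreover have "0 \<le> \<rho> * B I c" using \<rho> B by simp
    ultimately show ?thesis by (simp add: algebra_simps)
  next
    case False
    then have "(real (card S) - 2 * \<rho>) * spread I y \<le> 0"
      by (intro mult_nonpos_nonneg spread_nonneg) auto
    moreover have "\<rho> * B I c \<le> real (card S) * B I c"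
      using \<rho> B by (intro mult_right_mono)
    ultimately show ?thesis by simp
  qed
  finally show False using gt by simp
qed

text \<open>The lost edges are those through \<open>j\<close>. Padding with zeros keeps the index
  set independent of \<open>j\<close>, so that sums over \<open>j\<close> can be swapped with sums
  over edges.\<close>

lemma induced_weight_diff_remove:
  assumes "finite S"
  shows "induced_weight r w S - induced_weight r w (S - {j})
    = (\<Sum>R\<in>nsets S r. if j \<in> R then w R else 0)"
proof -
  have "nsets (S - {j}) r = {R \<in> nsets S r. j \<notin> R}"
    by (auto simp: nsets_def)
  then have "induced_weight r w (S - {j}) = (\<Sum>R\<in>nsets S r. if j \<notin> R then w R else 0)"
    unfolding induced_weight_def using finite_imp_finite_nsets[OF assms] by (simp add: sum.inter_filter)
  then show ?thesis
    by (simp add: induced_weight_def flip: sum_subtractf) (intro sum.cong; auto)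
qed

text \<open>Double counting: every edge is lost once for each of its \<open>r\<close>
  vertices.\<close>

lemma sum_induced_weight_diff_remove:
  assumes "finite S"
  shows "(\<Sum>j\<in>S. induced_weight r w S - induced_weight r w (S - {j}))
    = real r * induced_weight r w S"
proof -
  have "(\<Sum>j\<in>S. if j \<in> R then w R else 0) = real r * w R" if "R \<in> nsets S r" for R
  proof -
    have "S \<inter> R = R" "card R = r" using that by (auto simp: nsets_def)
    then show ?thesis using assms by (simp flip: sum.inter_restrict)
  qed
  then show ?thesis
    by (simp add: induced_weight_diff_remove[OF assms] sum.swap[of _ _ S])
      (simp add: induced_weight_def sum_distrib_left)
qed

lemma induced_weight_diff_remove_nonneg:
  assumes "finite S" "\<And>R. R \<in> nsets S r \<Longrightarrow> 0 \<le> w R"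
  shows "0 \<le> induced_weight r w S - induced_weight r w (S - {j})"
  unfolding induced_weight_diff_remove[OF assms(1)] using assms(2) by (intro sum_nonneg) auto

lemma induced_weight_mono:
  assumes "finite V" "S \<subseteq> V" "\<And>R. R \<in> nsets V r \<Longrightarrow> 0 \<le> w R"
  shows "induced_weight r w S \<le> induced_weight r w V"
  unfolding induced_weight_def
  using assms nsets_mono[OF assms(2)] finite_imp_finite_nsets[OF assms(1)] by (intro sum_mono2) auto

text \<open>Edges of \<open>S\<close> through \<open>j\<close> are edges of \<open>V\<close> through
  \<open>j\<close>, so a degree bound in the full vertex set passes to every subset.\<close>

lemma induced_weight_diff_remove_mono:
  assumes "finite V" "S \<subseteq> V" "\<And>R. R \<in> nsets V r \<Longrightarrow> 0 \<le> w R"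
  shows "induced_weight r w S - induced_weight r w (S - {j})
    \<le> induced_weight r w V - induced_weight r w (V - {j})"
  unfolding induced_weight_diff_remove[OF assms(1)]
    induced_weight_diff_remove[OF finite_subset[OF assms(2,1)]]
  using assms nsets_mono[OF assms(2)] finite_imp_finite_nsets[OF assms(1)] by (intro sum_mono2) auto

lemma induced_weight_eq_0:
  assumes "finite S" "card S < r"
  shows "induced_weight r w S = 0"
  using assms by (simp add: induced_weight_def nsets_eq_empty)

text \<open>Greedy deletion, by induction on \<open>card V\<close>: a chain for
  \<open>V - {j}\<close> is extended by \<open>V\<close> on top. Indexing by cardinality makes the
  deletion order an increasing chain.\<close>

lemma exists_removal_chain:
  assumes "finite V" "P V"
    and "\<And>S. S \<subseteq> V \<Longrightarrow> S \<noteq> {} \<Longrightarrow> P S \<Longrightarrow> \<exists>j\<in>S. P (S - {j})"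
  shows "\<exists>f. f (card V) = V \<and> (\<forall>m \<le> card V. f m \<subseteq> V \<and> card (f m) = m \<and> P (f m))
    \<and> (\<forall>m < card V. f m \<subset> f (Suc m))"
  using assms
proof (induction "card V" arbitrary: V)
  case 0
  then show ?case by (intro exI[of _ "\<lambda>_. V"]) auto
next
  case (Suc N)
  then have "V \<noteq> {}" by auto
  then obtain j where j: "j \<in> V" "P (V - {j})" using Suc.prems by blast
  have N: "N = card (V - {j})" using Suc.hyps(2) Suc.prems(1) j by simp
  have "\<exists>i\<in>S. P (S - {i})" if "S \<subseteq> V - {j}" "S \<noteq> {}" "P S" for S
    using Suc.prems(3)[of S] that by blast
  with Suc.hyps(1)[OF N _ j(2)] Suc.prems(1) N obtain f where
    f: "f N = V - {j}" "\<forall>m \<le> N. f m \<subseteq> V - {j} \<and> card (f m) = m \<and> P (f m)"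
      "\<forall>m < N. f m \<subset> f (Suc m)"
    by auto
  have "(f(Suc N := V)) m \<subset> (f(Suc N := V)) (Suc m)" if "m < Suc N" for m
    using that f(1,3) j(1) by (cases "m = N") auto
  moreover have "(f(Suc N := V)) m \<subseteq> V \<and> card ((f(Suc N := V)) m) = m \<and> P ((f(Suc N := V)) m)"
    if "m \<le> Suc N" for m
  proof (cases "m = Suc N")
    case True
    then show ?thesis using Suc.hyps(2) Suc.prems(2) by simp
  next
    case False
    then have "m \<le> N" using that by simp
    then show ?thesis using f(2) False by auto
  qed
  ultimately show ?case
    unfolding Suc.hyps(2)[symmetric] by (intro exI[of _ "f(Suc N := V)"]) simp
qed

theorem theorem2p2:
  fixes k n r :: nat and c :: real and w :: "nat \<Rightarrow> nat set \<Rightarrow> real"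
  assumes "2 \<le> k"
    and "0 < c" and "c < 1/2"
    and "1 \<le> r" and "r \<le> n"
    and "\<forall>i \<in> {1..k}. weighted_hypergraph n r (w i)"
    and "\<forall>i \<in> {1..k}. \<forall>j \<in> {1..n}. induced_weight r (w i) ({1..n} - {j}) \<ge> 1 - c"
  shows "\<exists>S :: nat \<Rightarrow> nat set.
           {} \<subset> S 1 \<and> (\<forall>j \<in> {1..<n}. S j \<subset> S (j + 1)) \<and> S n = {1..n} \<and>
           (\<forall>i\<^sub>1 \<in> {1..k}. \<forall>i\<^sub>2 \<in> {1..k}. \<forall>j \<in> {1..n}.
              \<bar>induced_weight r (w i\<^sub>1) (S j) - induced_weight r (w i\<^sub>2) (S j)\<bar>
                \<le> sqrt (2 * (real k - 1) * c))"
proof -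
  define y where "y S i = induced_weight r (w i) S" for S i
  define B where "B = 2 * real k * (real k - 1) * c"
  have nonneg: "0 \<le> w i R" if "i \<in> {1..k}" "R \<in> nsets {1..n} r" for i R
    using assms(6) that by (auto simp: weighted_hypergraph_def)
  have total: "y {1..n} i = 1" if "i \<in> {1..k}" for i
    using assms(6) that by (auto simp: weighted_hypergraph_def y_def induced_weight_def)
  have "B \<ge> 0" using assms(1,2) by (simp add: B_def)
  have step: "\<exists>j\<in>S. spread {1..k} (y (S - {j})) \<le> B"
    if S: "S \<subseteq> {1..n}" "S \<noteq> {}" and le: "spread {1..k} (y S) \<le> B" for S
  proof -
    have fin: "finite S" using S finite_subset by blast
    \<comment> \<open>Below \<open>r\<close> vertices all weights vanish, so any factor satisfies
      the averaging identity; 0 is chosen because the factor may not exceed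
      \<open>card S\<close>.\<close>
    define \<rho> where "\<rho> = (if card S < r then 0 else real r)"
    have x: "0 \<le> y S i - y (S - {j}) i \<and> y S i - y (S - {j}) i \<le> c"
      if i: "i \<in> {1..k}" and j: "j \<in> S" for i j
    proof
      show "0 \<le> y S i - y (S - {j}) i"
        unfolding y_def using nonneg[OF i] nsets_mono[OF S(1)] fin
        by (intro induced_weight_diff_remove_nonneg) auto
      have "y S i - y (S - {j}) i \<le> y {1..n} i - y ({1..n} - {j}) i"
        unfolding y_def using nonneg[OF i] S(1) by (intro induced_weight_diff_remove_mono) auto
      also have "\<dots> \<le> c"
        using total[OF i] assms(7) i j S(1) by (force simp: y_def)
      finally show "y S i - y (S - {j}) i \<le> c" .
    qed
    have avg: "(\<Sum>j\<in>S. y S i - y (S - {j}) i) = \<rho> * y S i" for i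
      unfolding y_def sum_induced_weight_diff_remove[OF fin]
      by (simp add: \<rho>_def induced_weight_eq_0[OF fin])
    have y1: "y S i \<le> 1" if i: "i \<in> {1..k}" for i
      using induced_weight_mono[where r = r and w = "w i", OF _ S(1) nonneg[OF i]] total[OF i]
      by (simp add: y_def)
    have "\<exists>j\<in>S. spread {1..k} (\<lambda>i. y S i - (y S i - y (S - {j}) i))
        \<le> 2 * real (card {1..k}) * (real (card {1..k}) - 1) * c"
      by (rule exists_spread_diff_le[where \<rho> = \<rho>, OF _ _ fin S(2) x avg y1])
        (use assms(1,2) le in \<open>auto simp: \<rho>_def B_def\<close>)
    then show ?thesis by (simp add: B_def)
  qed
  have "spread {1..k} (y {1..n}) \<le> B"
    using spread_eq_0[of "{1..k}" "y {1..n}" 1] total \<open>B \<ge> 0\<close> by simp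
  from exists_removal_chain[of "{1..n}" "\<lambda>S. spread {1..k} (y S) \<le> B", OF _ this step]
  obtain f where f: "f n = {1..n}"
      "\<forall>m \<le> n. f m \<subseteq> {1..n} \<and> card (f m) = m \<and> spread {1..k} (y (f m)) \<le> B"
      "\<forall>m < n. f m \<subset> f (Suc m)"
    by auto
  show ?thesis
  proof (intro exI[of _ f] conjI ballI)
    \<comment> \<open>The chain \<open>f\<close> starts with the empty set at index 0; index 1 is in
      range since \<open>1 \<le> r \<le> n\<close>.\<close>
    have "card (f 1) = 1" using f(2) assms(4,5) by simp
    then show "{} \<subset> f 1" by auto
    show "f j \<subset> f (j + 1)" if "j \<in> {1..<n}" for j using f(3) that by simp
    show "f n = {1..n}" by (fact f(1))
    fix a b j assume a: "a \<in> {1..k}" and b: "b \<in> {1..k}" and "j \<in> {1..n}"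
    then have "spread {1..k} (y (f j)) \<le> B" using f(2) by simp
    \<comment> \<open>Cancelling \<open>k\<close> from \<open>B\<close> leaves exactly the square of
      the claimed bound.\<close>
    with card_mult_diff_square_le_spread[OF _ a b, of "y (f j)"]
    have "real k * (y (f j) a - y (f j) b)\<^sup>2 \<le> real k * (2 * (real k - 1) * c)"
      by (simp add: B_def mult_ac)
    then have "(y (f j) a - y (f j) b)\<^sup>2 \<le> 2 * (real k - 1) * c"
      using assms(1) by (simp add: mult_le_cancel_left)
    then show "\<bar>induced_weight r (w a) (f j) - induced_weight r (w b) (f j)\<bar>
        \<le> sqrt (2 * (real k - 1) * c)"
      unfolding y_def by (metis real_sqrt_le_mono real_sqrt_abs)
  qed
qed

end
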